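(* Let $n>2$. Each coefficient $H^*_m$ of the equivariant $H^*$-polynomial $H^*(\Delta_{2,n};S_n)[t]$ is an effective representation of $S_n$.
   Context: The second hypersimplex is $\Delta_{2,n}=\{x\in\mathbb R^n: 0\le x_i\le 1 \text{ for all } i,\ x_1+\dots+x_n=2\}$; $S_n$ acts on $\mathbb R^n$ by permuting coordinates and leaves $\Delta_{2,n}$ invariant. Equivariant $H^*$-series: for $d\ge 1$ let $\chi_d$ be the character of the permutation representation of $S_n$ on $d\Delta_{2,n}\cap\mathbb Z^n$, so $\chi_d(\sigma)=|\{x\in d\Delta_{2,n}\cap\mathbb Z^n:\sigma(x)=x\}|$; let $\chi_0$ be the trivial character. Let $\rho(\sigma)$ be the $n\times n$ permutation matrix of $\sigma$. Then $H^*(\Delta_{2,n};S_n)[t]=\sum_{m\ge0}H^*_mt^m$ is the power series with coefficients in the representation ring of $S_n$ (over $\mathbb C$, virtual representations identified with characters) defined by $\sum_{d\ge0}\chi_d(\sigma)t^d=\bigl(\sum_{m\ge0}H^*_m(\sigma)t^m\bigr)/\det(I_n-t\rho(\sigma))$ for all $\sigma\in S_n$. It is a polynomial in $t$. An element of the representation ring is effective if it is (the class of) a genuine representation, i.e. a non-negative integer combination of irreducible representations (the zero representation is allowed). *)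

theory Defs
  imports
    "Jordan_Normal_Form.Determinant"
    "HOL-Algebra.Sym_Groups"
    "HOL-Computational_Algebra.Formal_Power_Series"
begin

text \<open>Coordinates of a vector are numbered from 0, whereas \<^const>\<open>sym_group\<close> \<open>n\<close> permutes
  \<open>{1..n}\<close>; so the coordinate \<open>x\<^sub>i\<close>, with \<open>1 \<le> i \<le> n\<close>, is entry \<open>i - 1\<close> of the vector.\<close>

definition hypersimplex2 :: "nat \<Rightarrow> real vec set" where
  "hypersimplex2 n =
     {x \<in> carrier_vec n. (\<forall>i<n. 0 \<le> x $ i \<and> x $ i \<le> 1) \<and> (\<Sum>i<n. x $ i) = 2}"

definition lattice_points :: "nat \<Rightarrow> nat \<Rightarrow> real vec set" where
  "lattice_points n d =
     {y \<in> (\<lambda>x. real d \<cdot>\<^sub>v x) ` hypersimplex2 n. \<forall>i<n. y $ i \<in> \<int>}"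

text \<open>Column \<open>j\<close> of the permutation matrix of \<open>\<sigma>\<close> is the unit vector indexed by \<open>\<sigma> j\<close>.\<close>

definition perm_mat :: "nat \<Rightarrow> (nat \<Rightarrow> nat) \<Rightarrow> 'a :: {zero, one} mat" where
  "perm_mat n \<sigma> = mat n n (\<lambda>(i, j). if Suc i = \<sigma> (Suc j) then 1 else 0)"

lemma perm_mat_action:
  fixes x :: "'a :: semiring_1 vec"
  assumes "\<sigma> permutes {1..n}" "x \<in> carrier_vec n" "i < n"
  shows "(perm_mat n \<sigma> *\<^sub>v x) $ (\<sigma> (Suc i) - 1) = x $ i"
proof -
  have s: "\<sigma> (Suc i) \<in> {1..n}"
    using assms by (simp add: permutes_in_image del: atLeastAtMost_iff) simp
  have "\<sigma> (Suc i) = \<sigma> (Suc j) \<longleftrightarrow> i = j" for j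
    using permutes_inj[OF assms(1)] by (auto dest: injD)
  with s assms(2,3) show ?thesis
    by (auto simp: perm_mat_def scalar_prod_def if_distrib[of "\<lambda>c. c * _"] cong: if_cong)
qed

definition perm_char :: "nat \<Rightarrow> nat \<Rightarrow> (nat \<Rightarrow> nat) \<Rightarrow> nat" where
  "perm_char n d \<sigma> =
     (if d = 0 then 1 else card {x \<in> lattice_points n d. perm_mat n \<sigma> *\<^sub>v x = x})"

definition char_series :: "nat \<Rightarrow> (nat \<Rightarrow> nat) \<Rightarrow> complex fps" where
  "char_series n \<sigma> = Abs_fps (\<lambda>d. of_nat (perm_char n d \<sigma>))"

definition char_denom :: "nat \<Rightarrow> (nat \<Rightarrow> nat) \<Rightarrow> complex fps" where
  "char_denom n \<sigma> = det (1\<^sub>m n - fps_X \<cdot>\<^sub>m perm_mat n \<sigma>)"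

text \<open>The series is well defined by lemma \<open>hstar_series_eq\<close> below.\<close>

definition hstar_series :: "nat \<Rightarrow> (nat \<Rightarrow> nat) \<Rightarrow> complex fps" where
  "hstar_series n \<sigma> = (THE H. char_series n \<sigma> = H / char_denom n \<sigma>)"

definition hstar_coeff :: "nat \<Rightarrow> nat \<Rightarrow> (nat \<Rightarrow> nat) \<Rightarrow> complex" where
  "hstar_coeff n m \<sigma> = fps_nth (hstar_series n \<sigma>) m"

text \<open>The group \<open>GL(k, \<complex>)\<close>; the extra argument \<open>()\<close> is the unused record extension of
  \<^const>\<open>ring_mat\<close>.\<close>

definition GL_complex :: "nat \<Rightarrow> complex mat monoid" where
  "GL_complex k = units_of (ring_mat TYPE(complex) k ())"

definition mat_trace :: "'a :: comm_monoid_add mat \<Rightarrow> 'a" where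
  "mat_trace A = (\<Sum>i<dim_row A. A $$ (i, i))"

text \<open>An element of the complex representation ring of \<open>G\<close> is given by its character; only the
  values on \<open>carrier G\<close> matter. Dimension \<open>k = 0\<close> gives the zero representation.\<close>

definition effective_character :: "('g, 'b) monoid_scheme \<Rightarrow> ('g \<Rightarrow> complex) \<Rightarrow> bool" where
  "effective_character G \<chi> \<longleftrightarrow>
     (\<exists>k. \<exists>\<rho> \<in> hom G (GL_complex k). \<forall>g \<in> carrier G. \<chi> g = mat_trace (\<rho> g))"

lemma char_denom_nth_0: "fps_nth (char_denom n \<sigma>) 0 = 1"
proof -
  interpret h: comm_ring_hom "\<lambda>f :: complex fps. fps_nth f 0"
    by unfold_locales simp_all
  have "map_mat (\<lambda>f :: complex fps. fps_nth f 0) (1\<^sub>m n - fps_X \<cdot>\<^sub>m perm_mat n \<sigma>) = 1\<^sub>m n"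
    by (rule eq_matI) (auto simp: perm_mat_def)
  then show ?thesis
    unfolding char_denom_def h.hom_det[symmetric] by simp
qed

lemma hstar_series_unique: "\<exists>!H. char_series n \<sigma> = H / char_denom n \<sigma>"
proof -
  have u: "fps_nth (char_denom n \<sigma>) 0 \<noteq> 0"
    by (simp add: char_denom_nth_0)
  have "char_series n \<sigma> = H / char_denom n \<sigma> \<longleftrightarrow> H = char_series n \<sigma> * char_denom n \<sigma>" for H
    using u inverse_mult_eq_1[OF u] inverse_mult_eq_1'[OF u]
    by (auto simp: fps_divide_unit mult.assoc)
  then show ?thesis by simp
qed

lemma hstar_series_eq: "char_series n \<sigma> = hstar_series n \<sigma> / char_denom n \<sigma>"
  unfolding hstar_series_def by (rule theI'[OF hstar_series_unique])

text \<open>Hence \<^const>\<open>card\<close> is a true count in the definition of \<^const>\<open>perm_char\<close>.\<close>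

lemma finite_lattice_points: "finite (lattice_points n d)"
proof (rule finite_subset)
  let ?S = "{x \<in> \<int>. 0 \<le> x \<and> x \<le> real d}"
  show "lattice_points n d \<subseteq> vec_of_list ` {l. set l \<subseteq> ?S \<and> length l = n}"
  proof
    fix y assume y: "y \<in> lattice_points n d"
    then obtain x where x: "x \<in> hypersimplex2 n" "y = real d \<cdot>\<^sub>v x"
      by (auto simp: lattice_points_def)
    have dim: "dim_vec y = n"
      using x by (auto simp: hypersimplex2_def)
    have "y $ i \<in> ?S" if "i < n" for i
      using that x y by (auto simp: hypersimplex2_def lattice_points_def mult_left_le)
    then have "set (list_of_vec y) \<subseteq> ?S" "length (list_of_vec y) = n"
      using dim by (auto simp: in_set_conv_nth list_of_vec_index)
    then show "y \<in> vec_of_list ` {l. set l \<subseteq> ?S \<and> length l = n}"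
      by (intro image_eqI[of _ _ "list_of_vec y"]) (auto simp: vec_list)
  qed
  have "?S \<subseteq> real_of_int ` {0..int d}"
    by (auto elim!: Ints_cases)
  then have "finite ?S"
    by (rule finite_subset) simp
  then show "finite (vec_of_list ` {l. set l \<subseteq> ?S \<and> length l = n})"
    by (intro finite_imageI finite_lists_length_eq)
qed

end

theory Submission
  imports Defs "HOL-Combinatorics.Cycles" "HOL-Algebra.Group_Action"
begin

text \<open>The coefficients can be computed: \<open>H\<^sup>*\<^sub>m\<close> is the permutation character on the \<open>2 m\<close>-subsets of
  \<open>{1..n}\<close>, except that for \<open>m = 1\<close> the permutation character on \<open>{1..n}\<close> itself is subtracted
  (\<open>hstar_coeff_eq\<close>).

  A lattice point of \<open>d \<Delta>\<^sub>2\<^sub>,\<^sub>n\<close> is a vector of natural numbers with sum \<open>2 d\<close> and no entry above \<open>d\<close>. At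
  most one entry of a vector with sum \<open>2 d\<close> exceeds \<open>d\<close>, and lowering it by \<open>d + 1\<close> leaves a vector with
  sum \<open>d - 1\<close>. If \<open>F(t)\<close> counts the \<open>\<sigma>\<close>-invariant vectors by their sum, then
  \<open>\<Sum> \<chi>\<^sub>d(\<sigma>) t\<^sup>d\<close> is thus the even part of \<open>F\<close>, with \<open>t\<^sup>2\<close> renamed to \<open>t\<close>, minus
  \<open>t c F(t)\<close>, where \<open>c\<close> is the number of fixed points of \<open>\<sigma>\<close>
  (\<open>card_invariant_vectors_bounded\<close>). Writing vectors as \<open>2 y + 1\<^sub>A\<close> shows that this even part is
  \<open>G(t) F(t)\<close>, where \<open>G\<close> counts the invariant subsets \<open>A\<close> of even size
  (\<open>card_invariant_vectors_double\<close>). Finally \<open>F\<close> is the inverse of \<open>det (1 - t \<sigma>)\<close>, both being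
  products over the cycles of \<open>\<sigma>\<close> (\<open>exterior_times_symmetric\<close>, \<open>det_one_minus_permutation\<close>), and so
  \<open>H\<^sup>*(\<sigma>) = G - c t\<close>.

  Permutation characters are effective, which settles \<open>m \<noteq> 1\<close>. For \<open>m = 1\<close> the coefficient is the
  character of the kernel of the map from edges to vertices of the complete graph that adds the two
  end points of an edge; for \<open>n > 2\<close> this map is surjective, because the graph contains a triangle
  (\<open>effective_pairs_minus_points\<close>).\<close>

section \<open>Exterior and symmetric powers of a permutation\<close>

lemma constant_on_cycle:
  assumes "cycle cs" "\<And>x. x \<in> set cs \<Longrightarrow> f (cycle_of_list cs x) = f x"
    and "x \<in> set cs" "y \<in> set cs"
  shows "f x = f y"
proof -
  have rot: "map (cycle_of_list cs) cs = rotate1 cs"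
    using cyclic_rotation[OF assms(1), of 1] by simp
  have step: "f (cs ! Suc i) = f (cs ! i)" if "Suc i < length cs" for i
  proof -
    have "cycle_of_list cs (cs ! i) = map (cycle_of_list cs) cs ! i"
      using that by simp
    also have "\<dots> = cs ! Suc i"
      using that unfolding rot by (simp add: nth_rotate1)
    finally show ?thesis
      using that assms(2)[of "cs ! i"] by simp
  qed
  have "f (cs ! i) = f (cs ! 0)" if "i < length cs" for i
    using that by (induction i) (use step in auto)
  then show ?thesis
    using assms(3,4) by (metis in_set_conv_nth)
qed

text \<open>This is the coefficient \<open>-1\<close> of \<open>t\<^sup>l\<close> in \<open>det (1 - t c) = 1 - t\<^sup>l\<close> for a cycle \<open>c\<close> of length \<open>l\<close>.\<close>

lemma sign_cycle_of_list:
  assumes "cycle cs" "cs \<noteq> []"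
  shows "(- 1) ^ length cs * sign (cycle_of_list cs) = - 1"
  using assms
proof (induction cs rule: cycle_of_list.induct)
  case (1 i j cs)
  then show ?case
    using sign_compose[OF permutation_swap_id permutation_of_cycle, of i j "j # cs"]
    by (simp add: sign_swap_id del: comp_apply)
qed auto

definition invariant_subsets :: "'a set \<Rightarrow> ('a \<Rightarrow> 'a) \<Rightarrow> 'a set set" where
  "invariant_subsets S p = {A. A \<subseteq> S \<and> p ` A = A}"

text \<open>The series \<open>\<Sum>\<^sub>k (- t)\<^sup>k tr (\<Lambda>\<^sup>k p)\<close>: in the basis of wedges of coordinate vectors, an invariant
  subset contributes to the trace the sign of the permutation that \<open>p\<close> induces on it.\<close>

definition exterior_fps :: "'a set \<Rightarrow> ('a \<Rightarrow> 'a) \<Rightarrow> complex fps" where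
  "exterior_fps S p = (\<Sum>A\<in>invariant_subsets S p.
     of_int ((- 1) ^ card A * sign (restrict_id p A)) * fps_X ^ card A)"

definition invariant_vectors :: "'a set \<Rightarrow> ('a \<Rightarrow> 'a) \<Rightarrow> nat \<Rightarrow> ('a \<Rightarrow> nat) set" where
  "invariant_vectors S p d =
     {f. (\<forall>x. x \<notin> S \<longrightarrow> f x = 0) \<and> (\<forall>x\<in>S. f (p x) = f x) \<and> sum f S = d}"

text \<open>The series \<open>\<Sum>\<^sub>d t\<^sup>d tr (Sym\<^sup>d p)\<close>: \<open>p\<close> permutes the monomials of degree \<open>d\<close>, whose exponent vectors
  are the vectors of natural numbers with sum \<open>d\<close>.\<close>

definition symmetric_fps :: "'a set \<Rightarrow> ('a \<Rightarrow> 'a) \<Rightarrow> complex fps" where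
  "symmetric_fps S p = Abs_fps (\<lambda>d. of_nat (card (invariant_vectors S p d)))"

lemma finite_invariant_subsets: "finite S \<Longrightarrow> finite (invariant_subsets S p)"
  by (rule finite_subset[of _ "Pow S"]) (auto simp: invariant_subsets_def)

lemma finite_invariant_vectors:
  assumes "finite S"
  shows "finite (invariant_vectors S p d)"
proof (rule finite_subset)
  show "invariant_vectors S p d \<subseteq> {f. \<forall>x. (x \<in> S \<longrightarrow> f x \<in> {..d}) \<and> (x \<notin> S \<longrightarrow> f x = 0)}"
    using assms by (auto simp: invariant_vectors_def member_le_sum)
  show "finite {f. \<forall>x. (x \<in> S \<longrightarrow> f x \<in> {..d}) \<and> (x \<notin> S \<longrightarrow> f x = (0::nat))}"
    using assms by (intro finite_set_of_finite_funs) auto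
qed

text \<open>An invariant subset contains a given cycle entirely or is disjoint from it. Adding a cycle of
  length \<open>l\<close> to an invariant subset multiplies its term by \<open>(- 1)\<^sup>l (- 1)\<^sup>l\<^sup>-\<^sup>1 t\<^sup>l = - t\<^sup>l\<close>.\<close>

lemma exterior_fps_add_cycle:
  assumes p: "p permutes I" and I: "finite I" and cs: "cycle cs" "cs \<noteq> []" "set cs \<inter> I = {}"
  shows "exterior_fps (set cs \<union> I) (cycle_of_list cs \<circ> p) =
    (1 - fps_X ^ length cs) * exterior_fps I p"
proof -
  let ?C = "set cs" and ?c = "cycle_of_list cs"
  let ?q = "?c \<circ> p"
  let ?w = "\<lambda>p A. of_int ((- 1) ^ card A * sign (restrict_id p A)) * fps_X ^ card A :: complex fps"
  have c: "?c permutes ?C" by (rule cycle_permutes)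
  have qC: "?q x = ?c x" if "x \<in> ?C" for x
    using that cs(3) permutes_not_in[OF p] by (metis comp_apply disjoint_iff)
  have qI: "?q x = p x" if "x \<in> I" for x
    using that cs(3) permutes_not_in[OF c] permutes_in_image[OF p] by fastforce
  have qimI: "?q ` A = p ` A" if "A \<subseteq> I" for A
    using that qI by (intro image_cong) auto
  have qimC: "?q ` ?C = ?C"
    using qC permutes_image[OF c] by (simp cong: image_cong)
  \<comment> \<open>The indicator of an invariant set is constant on the cycle.\<close>
  have inv: "invariant_subsets (?C \<union> I) ?q =
      invariant_subsets I p \<union> (\<union>) ?C ` invariant_subsets I p" (is "?L = ?R")
  proof (intro equalityI subsetI)
    fix A assume "A \<in> ?L"
    then have A: "A \<subseteq> ?C \<union> I" "?q ` A = A" by (auto simp: invariant_subsets_def)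
    have inj: "inj ?q"
      using permutes_inj[OF p] permutes_inj[OF c] by (auto intro: inj_compose)
    have iff: "?q x \<in> A \<longleftrightarrow> x \<in> A" for x
      using A(2) inj by (metis inj_image_mem_iff)
    have "x \<in> A \<longleftrightarrow> y \<in> A" if "x \<in> ?C" "y \<in> ?C" for x y
      using constant_on_cycle[OF cs(1), of "\<lambda>x. x \<in> A"] iff qC that by metis
    then have C: "A \<inter> ?C = {} \<or> ?C \<subseteq> A" by blast
    have "?q ` (A \<inter> I) = ?q ` A \<inter> ?q ` I"
      using inj by (rule image_Int)
    also have "\<dots> = A \<inter> I"
      using A(2) qimI[of I] permutes_image[OF p] by (simp del: comp_apply)
    finally have "A \<inter> I \<in> invariant_subsets I p"
      using qimI[of "A \<inter> I"] by (simp add: invariant_subsets_def)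
    moreover have "A = A \<inter> I \<or> A = ?C \<union> (A \<inter> I)"
      using C A(1) by blast
    ultimately show "A \<in> ?R" by (metis UnI1 UnI2 image_eqI)
  next
    fix A assume "A \<in> ?R"
    then obtain B where B: "B \<in> invariant_subsets I p" "A = B \<or> A = ?C \<union> B" by blast
    then have "B \<subseteq> I" "?q ` B = B"
      using qimI by (auto simp: invariant_subsets_def simp del: comp_apply)
    then have "?q ` A = A"
      using B(2) image_Un[of ?q ?C B] qimC by metis
    then show "A \<in> ?L"
      using B(2) \<open>B \<subseteq> I\<close> unfolding invariant_subsets_def by blast
  qed
  have w0: "?w ?q A = ?w p A" if "A \<in> invariant_subsets I p" for A
  proof -
    have "restrict_id ?q A = restrict_id p A"
      using that qI by (auto simp: restrict_id_def invariant_subsets_def fun_eq_iff)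
    then show ?thesis by simp
  qed
  have w1: "?w ?q (?C \<union> A) = - (fps_X ^ length cs * ?w p A)" if "A \<in> invariant_subsets I p" for A
  proof -
    have A: "A \<subseteq> I" "p ` A = A" using that by (auto simp: invariant_subsets_def)
    have fin: "finite A" using A(1) I finite_subset by blast
    have pA: "restrict_id p A permutes A"
      by (rule permutes_restrict_id)
        (use A permutes_inj_on[OF p] in \<open>auto simp: bij_betw_def\<close>)
    have "restrict_id ?q (?C \<union> A) = ?c \<circ> restrict_id p A"
    proof
      fix x show "restrict_id ?q (?C \<union> A) x = (?c \<circ> restrict_id p A) x"
        using A cs(3) qC[of x] permutes_not_in[OF c, of x] 
        by (cases "x \<in> A"; cases "x \<in> ?C") auto
    qed
    then have "sign (restrict_id ?q (?C \<union> A)) = sign ?c * sign (restrict_id p A)"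
      using sign_compose[OF permutation_of_cycle, of "restrict_id p A" cs] pA fin
      by (metis permutation_permutes)
    moreover have "card (?C \<union> A) = length cs + card A"
      using A cs fin by (subst card_Un_disjoint) (auto simp: distinct_card)
    ultimately have "(- 1) ^ card (?C \<union> A) * sign (restrict_id ?q (?C \<union> A)) =
        ((- 1) ^ length cs * sign ?c) * ((- 1) ^ card A * sign (restrict_id p A))"
      by (simp add: power_add)
    then show ?thesis
      using \<open>card (?C \<union> A) = _\<close> by (simp add: sign_cycle_of_list[OF cs(1,2)] power_add)
  qed
  have ne: "?C \<noteq> {}" using cs(2) by simp
  have inj: "inj_on ((\<union>) ?C) (invariant_subsets I p)"
    using cs(3) by (auto simp: inj_on_def invariant_subsets_def)
  have "exterior_fps (?C \<union> I) ?q = sum (?w ?q) (invariant_subsets I p) +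
      sum (?w ?q) ((\<union>) ?C ` invariant_subsets I p)"
    unfolding exterior_fps_def inv
  proof (rule sum.union_disjoint)
    show fin: "finite (invariant_subsets I p)"
      using I by (rule finite_invariant_subsets)
    then show "finite ((\<union>) ?C ` invariant_subsets I p)" by (rule finite_imageI)
    have "\<not> ?C \<subseteq> I" using ne cs(3) by (metis Int_absorb2)
    then show "invariant_subsets I p \<inter> (\<union>) ?C ` invariant_subsets I p = {}"
      unfolding invariant_subsets_def by blast
  qed
  also have "\<dots> = sum (?w p) (invariant_subsets I p) -
      fps_X ^ length cs * sum (?w p) (invariant_subsets I p)"
    using w0 w1 by (simp add: sum.reindex[OF inj] sum_distrib_left sum_negf)
  finally show ?thesis
    by (simp add: exterior_fps_def algebra_simps)
qed

text \<open>An invariant vector is constant on a cycle of length \<open>l\<close>, and its value \<open>k\<close> there contributes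
  \<open>k l\<close> to the sum: the new factor is the geometric series \<open>\<Sum>\<^sub>k t\<^sup>k\<^sup>l\<close>.\<close>

lemma symmetric_fps_add_cycle:
  assumes p: "p permutes I" and I: "finite I" and cs: "cycle cs" "cs \<noteq> []" "set cs \<inter> I = {}"
  shows "(1 - fps_X ^ length cs) * symmetric_fps (set cs \<union> I) (cycle_of_list cs \<circ> p) =
    symmetric_fps I p"
proof -
  let ?C = "set cs" and ?c = "cycle_of_list cs" and ?l = "length cs"
  let ?q = "?c \<circ> p"
  let ?V = "invariant_vectors (?C \<union> I) ?q" and ?W = "invariant_vectors I p"
  let ?s = "\<lambda>f x. f x + (if x \<in> ?C then 1 else 0) :: nat"
  have c: "?c permutes ?C" by (rule cycle_permutes)
  have qC: "?q x = ?c x" if "x \<in> ?C" for x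
    using that cs(3) permutes_not_in[OF p] by (metis comp_apply disjoint_iff)
  have qI: "?q x = p x" if "x \<in> I" for x
    using that cs(3) permutes_not_in[OF c] permutes_in_image[OF p] by fastforce
  have sum: "sum f (?C \<union> I) = sum f ?C + sum f I" for f :: "_ \<Rightarrow> nat"
    using I cs(3) by (intro sum.union_disjoint) auto
  have l: "card ?C = ?l" using cs(1) by (rule distinct_card)
  have V: "f \<in> ?V d \<longleftrightarrow> (\<forall>x. x \<notin> ?C \<union> I \<longrightarrow> f x = 0) \<and> (\<forall>x\<in>?C. f (?c x) = f x) \<and>
      (\<forall>x\<in>I. f (p x) = f x) \<and> sum f ?C + sum f I = d" for f d
  proof -
    have "(\<forall>x\<in>?C \<union> I. f (?q x) = f x) \<longleftrightarrow>
        (\<forall>x\<in>?C. f (?c x) = f x) \<and> (\<forall>x\<in>I. f (p x) = f x)"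
      using qC qI by (metis Un_iff)
    then show ?thesis
      unfolding invariant_vectors_def mem_Collect_eq sum by blast
  qed
  have disj: "x \<notin> I" if "x \<in> ?C" for x using that cs(3) by blast
  have cC: "?c x \<in> ?C \<longleftrightarrow> x \<in> ?C" for x using permutes_in_image[OF c] .
  have pI: "p x \<in> I \<longleftrightarrow> x \<in> I" for x using permutes_in_image[OF p] .
  have W: "?W d = {f \<in> ?V d. \<forall>x\<in>?C. f x = 0}" for d
    unfolding set_eq_iff mem_Collect_eq V
    using disj cC by (auto simp: invariant_vectors_def)
  have sI: "sum (?s f) I = sum f I" for f
    using disj by (intro sum.cong) auto
  have sC: "sum (?s f) ?C = sum f ?C + ?l" for f
    by (simp add: sum_Suc l)
  have pC: "p x \<notin> ?C" if "x \<in> I" for x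
    using that disj pI by blast
  \<comment> \<open>An invariant vector that is nonzero somewhere on the cycle is positive on all of it, so the
    indicator of the cycle can be subtracted.\<close>
  have shift: "{f \<in> ?V d. \<not> (\<forall>x\<in>?C. f x = 0)} = (if ?l \<le> d then ?s ` ?V (d - ?l) else {})" for d
  proof (intro equalityI subsetI)
    fix f assume "f \<in> {f \<in> ?V d. \<not> (\<forall>x\<in>?C. f x = 0)}"
    then have f: "f \<in> ?V d" "\<exists>x\<in>?C. f x \<noteq> 0" by auto
    have "f x = f y" if "x \<in> ?C" "y \<in> ?C" for x y
      using constant_on_cycle[OF cs(1), of f] f(1) that V by blast
    then have pos: "f x \<ge> 1" if "x \<in> ?C" for x
      using f(2) that by (metis less_one not_le)
    define g where "g = (\<lambda>x. f x - (if x \<in> ?C then 1 else 0))"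
    have fg: "f = ?s g"
      using pos by (auto simp: g_def fun_eq_iff)
    have "sum f ?C = sum g ?C + ?l" "sum f I = sum g I"
      using sC[of g] sI[of g] unfolding fg by auto
    moreover have "sum f ?C + sum f I = d" using f(1) V by blast
    ultimately have s: "?l \<le> d" "sum g ?C + sum g I = d - ?l" by auto
    have "g \<in> ?V (d - ?l)"
      unfolding V using f(1) s(2) cC pC disj unfolding V by (auto simp: g_def)
    then show "f \<in> (if ?l \<le> d then ?s ` ?V (d - ?l) else {})"
      using fg s(1) by auto
  next
    fix f assume "f \<in> (if ?l \<le> d then ?s ` ?V (d - ?l) else {})"
    then obtain g where g: "?l \<le> d" "g \<in> ?V (d - ?l)" "f = ?s g"
      by (auto split: if_splits)
    have "sum f ?C + sum f I = d"
      using g(1,2) V[of g "d - ?l"] unfolding g(3) sI sC by auto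
    moreover obtain x where "x \<in> ?C" using cs(2) by (metis list.set_sel(1))
    ultimately show "f \<in> {f \<in> ?V d. \<not> (\<forall>x\<in>?C. f x = 0)}"
      using g(2) disj cC pC unfolding mem_Collect_eq V g(3) by auto
  qed
  have card: "card (?V d) = card (?W d) + (if ?l \<le> d then card (?V (d - ?l)) else 0)" for d
  proof -
    have inj: "inj_on ?s X" for X
      by (auto simp: inj_on_def fun_eq_iff)
    have "?V d = ?W d \<union> {f \<in> ?V d. \<not> (\<forall>x\<in>?C. f x = 0)}"
      unfolding W by blast
    then have "card (?V d) = card (?W d \<union> {f \<in> ?V d. \<not> (\<forall>x\<in>?C. f x = 0)})" by simp
    also have "\<dots> = card (?W d) + card {f \<in> ?V d. \<not> (\<forall>x\<in>?C. f x = 0)}"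
    proof (rule card_Un_disjoint)
      show "finite (?W d)" using I by (rule finite_invariant_vectors)
      have "finite (?V d)" using I by (intro finite_invariant_vectors) simp
      then show "finite {f \<in> ?V d. \<not> (\<forall>x\<in>?C. f x = 0)}" by simp
    qed (use W in auto)
    also have "card {f \<in> ?V d. \<not> (\<forall>x\<in>?C. f x = 0)} = (if ?l \<le> d then card (?V (d - ?l)) else 0)"
      unfolding shift by (simp add: card_image[OF inj])
    finally show ?thesis .
  qed
  show ?thesis
  proof (rule fps_ext)
    fix d
    show "fps_nth ((1 - fps_X ^ ?l) * symmetric_fps (?C \<union> I) ?q) d = fps_nth (symmetric_fps I p) d"
      using card[of d]
      by (simp add: symmetric_fps_def left_diff_distrib fps_X_power_mult_nth)
  qed
qed

text \<open>This is the Koszul duality \<open>\<Lambda>\<^sub>-\<^sub>t Sym\<^sub>t = 1\<close> at the level of traces. Both factors are products over the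
  cycles of \<open>p\<close>, with mutually inverse contributions \<open>1 - t\<^sup>l\<close> and \<open>1 / (1 - t\<^sup>l)\<close>.\<close>

lemma exterior_times_symmetric:
  fixes p :: "'a \<Rightarrow> 'a"
  assumes "p permutes S" "finite S"
  shows "exterior_fps S p * symmetric_fps S p = 1"
proof -
  have "finite S \<and> p permutes S \<and> exterior_fps S p * symmetric_fps S p = 1"
    if "cycle_decomp S p" for S and p :: "'a \<Rightarrow> 'a"
    using that
  proof (induction rule: cycle_decomp.induct)
    case empty
    have "invariant_subsets {} id = {{} :: 'a set}"
      by (auto simp: invariant_subsets_def)
    moreover have "invariant_vectors {} id d = (if d = 0 then {\<lambda>_ :: 'a. 0} else {})" for d
      by (auto simp: invariant_vectors_def)
    moreover have "Abs_fps (\<lambda>d. of_nat (card (if d = 0 then {\<lambda>_ :: 'a. 0 :: nat} else {}))) = (1 :: complex fps)"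
      by (rule fps_ext) simp
    moreover have "restrict_id id {} = (id :: 'a \<Rightarrow> 'a)"
      by (auto simp: restrict_id_def)
    ultimately show ?case
      by (simp add: exterior_fps_def symmetric_fps_def permutes_id del: id_apply cong del: restrict_id_cong)
  next
    case (comp I p cs)
    show ?case
    proof (cases "cs = []")
      case True
      with comp show ?thesis by simp
    next
      case False
      have "cycle_of_list cs \<circ> p permutes set cs \<union> I"
        using comp.IH cycle_permutes[of cs]
        by (intro permutes_compose) (auto intro: permutes_subset)
      moreover have "exterior_fps (set cs \<union> I) (cycle_of_list cs \<circ> p) *
          symmetric_fps (set cs \<union> I) (cycle_of_list cs \<circ> p) = exterior_fps I p * symmetric_fps I p"
        unfolding symmetric_fps_add_cycle[OF _ _ comp.hyps(2) False comp.hyps(3), of p, symmetric]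
        using comp False by (simp add: exterior_fps_add_cycle symmetric_fps_add_cycle[symmetric] mult_ac)
      ultimately show ?thesis using comp.IH by (simp del: comp_apply)
    qed
  qed
  then show ?thesis using cycle_decomposition[OF assms] by blast
qed

section \<open>The characteristic determinant\<close>

lemma prod_if_zero:
  assumes "finite A"
  shows "(\<Prod>x\<in>A. if P x then c else 0) = (if \<forall>x\<in>A. P x then c ^ card A else (0::'a::comm_semiring_1))"
  using assms by induction auto

text \<open>A permutation whose value at each point is dictated by \<open>A\<close> (follow \<open>t\<close> on \<open>A\<close>, stay put elsewhere)
  exists only if \<open>t\<close> preserves \<open>A\<close>. Hence the terms surviving in the Leibniz expansion below are
  indexed by the invariant subsets.\<close>

lemma restrict_id_unique:
  assumes t: "t permutes S" and A: "A \<subseteq> S"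
  shows "p permutes S \<and> (\<forall>j\<in>A. p j = t j) \<and> (\<forall>j\<in>S - A. p j = j) \<longleftrightarrow>
    A \<in> invariant_subsets S t \<and> p = restrict_id t A"
proof (intro iffI conjI)
  assume p: "p permutes S \<and> (\<forall>j\<in>A. p j = t j) \<and> (\<forall>j\<in>S - A. p j = j)"
  then have off: "p j = j" if "j \<notin> A" for j
    using that by (metis DiffI permutes_not_in)
  then show *: "p = restrict_id t A"
    using p by (auto simp: restrict_id_def)
  have "p permutes A"
    using p off by (auto intro: permutes_superset)
  then have "p ` A = A" by (rule permutes_image)
  moreover have "p ` A = t ` A" using p by (intro image_cong) auto
  ultimately show "A \<in> invariant_subsets S t"
    using A by (simp add: invariant_subsets_def)
next
  assume a: "A \<in> invariant_subsets S t \<and> p = restrict_id t A"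
  have "restrict_id t A permutes A"
    by (rule permutes_restrict_id)
      (use a permutes_inj_on[OF t] in \<open>auto simp: bij_betw_def invariant_subsets_def\<close>)
  with a A show "p permutes S" by (auto intro: permutes_subset)
qed auto

text \<open>The familiar expansion \<open>det (1 - X t) = \<Sum>\<^sub>k (- X)\<^sup>k tr (\<Lambda>\<^sup>k t)\<close>, obtained by multiplying out each product of
  the Leibniz formula.\<close>

lemma det_one_minus_permutation:
  assumes t: "t permutes {0..<n}"
  shows "det (mat n n (\<lambda>(i, j). (if i = j then 1 else 0) - (if i = t j then fps_X else 0))) =
    exterior_fps {0..<n} t"
proof -
  let ?N = "{0..<n}" and ?Inv = "invariant_subsets {0..<n} t"
  let ?M = "mat n n (\<lambda>(i, j). (if i = j then 1 else 0) - (if i = t j then fps_X else 0)) :: complex fps mat"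
  let ?P = "{p. p permutes ?N}"
  let ?w = "\<lambda>p A. signof p * ((- 1) ^ card A * fps_X ^ card A) :: complex fps"
  \<comment> \<open>Multiplying out, \<open>A\<close> is the set of columns in which the entry of \<open>- X t\<close> is chosen.\<close>
  have expand: "(\<Prod>j<n. ?M $$ (p j, j)) =
      (\<Sum>A\<in>Pow ?N. if A \<in> ?Inv \<and> p = restrict_id t A then (- 1) ^ card A * fps_X ^ card A else 0)"
    if p: "p \<in> ?P" for p
  proof -
    have "(\<Prod>j<n. ?M $$ (p j, j)) =
        (\<Prod>j\<in>?N. (if p j = j then 1 else 0) - (if p j = t j then fps_X else 0))"
    proof (intro prod.cong)
      fix j assume "j \<in> ?N"
      moreover have "p j \<in> ?N \<longleftrightarrow> j \<in> ?N"
        using p by (intro permutes_in_image) simp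
      ultimately show "?M $$ (p j, j) =
          (if p j = j then 1 else 0) - (if p j = t j then fps_X else 0)"
        by simp
    qed auto
    also have "\<dots> = (\<Sum>A\<in>Pow ?N. (- 1) ^ card A *
        (\<Prod>j\<in>A. if p j = t j then fps_X else 0) * (\<Prod>j\<in>?N - A. if p j = j then 1 else 0))"
      by (rule prod_diff_conv_sum) simp
    also have "\<dots> = (\<Sum>A\<in>Pow ?N. if A \<in> ?Inv \<and> p = restrict_id t A
        then (- 1) ^ card A * fps_X ^ card A else 0)"
    proof (intro sum.cong refl)
      fix A assume "A \<in> Pow ?N"
      then have A: "A \<subseteq> ?N" "finite A" using finite_subset by auto
      show "(- 1) ^ card A * (\<Prod>j\<in>A. if p j = t j then fps_X else 0) *
          (\<Prod>j\<in>?N - A. if p j = j then 1 else 0) =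
          (if A \<in> ?Inv \<and> p = restrict_id t A then (- 1) ^ card A * fps_X ^ card A else 0)"
        unfolding restrict_id_unique[OF t A(1), symmetric]
        using p A(2) by (simp add: prod_if_zero)
    qed
    finally show ?thesis .
  qed
  have "det ?M = (\<Sum>p\<in>?P. signof p * (\<Prod>j<n. ?M $$ (p j, j)))"
    by (rule det_col) simp
  also have "\<dots> = (\<Sum>p\<in>?P. \<Sum>A\<in>Pow ?N. if A \<in> ?Inv \<and> p = restrict_id t A then ?w p A else 0)"
  proof (intro sum.cong refl)
    fix p assume p: "p \<in> ?P"
    show "signof p * (\<Prod>j<n. ?M $$ (p j, j)) =
        (\<Sum>A\<in>Pow ?N. if A \<in> ?Inv \<and> p = restrict_id t A then ?w p A else 0)"
      unfolding expand[OF p] sum_distrib_left by (intro sum.cong refl) auto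
  qed
  also have "\<dots> = (\<Sum>A\<in>Pow ?N. \<Sum>p\<in>?P. if A \<in> ?Inv \<and> p = restrict_id t A then ?w p A else 0)"
    by (rule sum.swap)
  also have "\<dots> = (\<Sum>A\<in>Pow ?N. if A \<in> ?Inv then ?w (restrict_id t A) A else 0)"
  proof (intro sum.cong refl)
    fix A assume A: "A \<in> Pow ?N"
    have "restrict_id t A \<in> ?P" if "A \<in> ?Inv"
      using that A restrict_id_unique[OF t, of A "restrict_id t A"] by auto
    then show "(\<Sum>p\<in>?P. if A \<in> ?Inv \<and> p = restrict_id t A then ?w p A else 0) =
        (if A \<in> ?Inv then ?w (restrict_id t A) A else 0)"
      by (cases "A \<in> ?Inv") (auto simp: finite_permutations)
  qed
  also have "\<dots> = (\<Sum>A\<in>?Inv. ?w (restrict_id t A) A)"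
    by (rule sum.mono_neutral_cong_right) (auto simp: invariant_subsets_def)
  also have "\<dots> = exterior_fps ?N t"
    unfolding exterior_fps_def by (intro sum.cong refl) (simp add: mult_ac)
  finally show ?thesis .
qed

text \<open>Elements of the symmetric group act on \<open>{1..n}\<close>, whereas rows, columns and coordinates are numbered
  from 0; this is the permutation transported to \<open>{0..<n}\<close>.\<close>

definition zero_based :: "(nat \<Rightarrow> nat) \<Rightarrow> nat \<Rightarrow> nat" where
  "zero_based \<sigma> = (\<lambda>j. \<sigma> (Suc j) - 1)"

lemma Suc_zero_based:
  assumes "\<sigma> permutes {1..n}"
  shows "Suc (zero_based \<sigma> j) = \<sigma> (Suc j)"
proof -
  have "\<sigma> 0 = 0" using assms by (simp add: permutes_not_in)
  then have "\<sigma> (Suc j) \<noteq> 0"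
    using injD[OF permutes_inj[OF assms], of "Suc j" 0] by auto
  then show ?thesis by (simp add: zero_based_def)
qed

lemma zero_based_permutes:
  assumes "\<sigma> permutes {1..n}"
  shows "zero_based \<sigma> permutes {0..<n}"
proof (rule inj_imp_permutes)
  show "inj_on (zero_based \<sigma>) {0..<n}"
  proof (rule inj_onI)
    fix i j assume "zero_based \<sigma> i = zero_based \<sigma> j"
    then have "\<sigma> (Suc i) = \<sigma> (Suc j)" by (metis Suc_zero_based[OF assms])
    then show "i = j" using injD[OF permutes_inj[OF assms]] by blast
  qed
  show "zero_based \<sigma> j \<in> {0..<n}" if "j \<in> {0..<n}" for j
  proof -
    have "\<sigma> (Suc j) \<in> {1..n}"
      using that permutes_in_image[OF assms, of "Suc j"] by simp
    then show ?thesis using Suc_zero_based[OF assms, of j] by auto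
  qed
  show "zero_based \<sigma> j = j" if "j \<notin> {0..<n}" for j
    using that permutes_not_in[OF assms, of "Suc j"] by (simp add: zero_based_def)
qed simp

lemma char_denom_eq_exterior_fps:
  assumes "\<sigma> permutes {1..n}"
  shows "char_denom n \<sigma> = exterior_fps {0..<n} (zero_based \<sigma>)"
  unfolding char_denom_def det_one_minus_permutation[OF zero_based_permutes[OF assms], symmetric]
  by (rule arg_cong[of _ _ det], rule eq_matI)
    (auto simp: perm_mat_def Suc_zero_based[OF assms, symmetric])

section \<open>Invariant lattice points\<close>

text \<open>Every vector of natural numbers is uniquely \<open>2 y + 1\<^sub>A\<close>, and it is invariant iff \<open>y\<close> and \<open>A\<close> are. As
  generating functions, \<open>F(s) = G(s) F(s\<^sup>2)\<close> with \<open>F\<close> counting vectors by sum and \<open>G\<close> counting subsets by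
  size; the lemma is the even part of this identity.\<close>

lemma card_invariant_vectors_double:
  assumes p: "p permutes S" and S: "finite S"
  shows "card (invariant_vectors S p (2 * d)) =
    (\<Sum>j\<le>d. card {A \<in> invariant_subsets S p. card A = 2 * j} * card (invariant_vectors S p (d - j)))"
proof -
  let ?V = "invariant_vectors S p"
  let ?I = "\<lambda>j. {A \<in> invariant_subsets S p. card A = 2 * j}"
  let ?X = "SIGMA j:{..d}. ?I j \<times> ?V (d - j)"
  \<comment> \<open>Binary digit extraction: \<open>A\<close> collects the odd entries of \<open>f\<close>, and \<open>f = 2 y + 1\<^sub>A\<close>.\<close>
  let ?odd = "\<lambda>f. {x \<in> S. odd (f x)}" 
  let ?f = "\<lambda>f :: 'a \<Rightarrow> nat. (card (?odd f) div 2, ?odd f, \<lambda>x. f x div 2)"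
  let ?g = "\<lambda>(j :: nat, A, y) x. 2 * y x + (if x \<in> A then 1 else 0) :: nat"
  have bal: "sum f S = 2 * (\<Sum>x\<in>S. f x div 2) + card (?odd f)" for f
  proof -
    have "sum f S = (\<Sum>x\<in>S. 2 * (f x div 2) + (if odd (f x) then 1 else 0))"
      by (intro sum.cong refl) (simp add: odd_two_times_div_two_succ)
    also have "\<dots> = 2 * (\<Sum>x\<in>S. f x div 2) + card (?odd f)"
      using S by (simp add: sum.distrib sum_distrib_left sum.If_cases Int_def)
    finally show ?thesis .
  qed
  have "bij_betw ?f (?V (2 * d)) ?X"
  proof (rule bij_betw_byWitness[where f' = ?g])
    show "\<forall>f\<in>?V (2 * d). ?g (?f f) = f"
      by (auto simp: invariant_vectors_def fun_eq_iff)
    show "\<forall>z\<in>?X. ?f (?g z) = z"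
    proof
      fix z assume "z \<in> ?X"
      then obtain j A y where z: "z = (j, A, y)" "A \<subseteq> S" "card A = 2 * j"
        by (auto simp: invariant_subsets_def)
      then have "?odd (?g z) = A" by auto
      with z show "?f (?g z) = z" by auto
    qed
    show "?f ` ?V (2 * d) \<subseteq> ?X"
    proof (rule image_subsetI)
      fix f assume f: "f \<in> ?V (2 * d)"
      have "sum f S = 2 * d" using f by (simp add: invariant_vectors_def)
      then have even: "even (card (?odd f))" and s: "(\<Sum>x\<in>S. f x div 2) + card (?odd f) div 2 = d"
        using bal[of f] by (presburger, presburger)
      have "?odd f \<in> invariant_subsets S p"
      proof -
        have "p ` ?odd f \<subseteq> ?odd f"
          using f permutes_in_image[OF p] by (auto simp: invariant_vectors_def)
        moreover have "card (p ` ?odd f) = card (?odd f)"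
          by (rule card_image[OF permutes_inj_on[OF p]])
        ultimately show ?thesis
          using S by (simp add: invariant_subsets_def card_subset_eq)
      qed
      with even s f show "?f f \<in> ?X"
        by (auto simp: invariant_vectors_def)
    qed
    show "?g ` ?X \<subseteq> ?V (2 * d)"
    proof (rule image_subsetI)
      fix z assume "z \<in> ?X"
      then obtain j A y where z: "z = (j, A, y)" "j \<le> d" "A \<subseteq> S" "p ` A = A" "card A = 2 * j"
          "y \<in> ?V (d - j)"
        by (auto simp: invariant_subsets_def)
      have "p x \<in> A \<longleftrightarrow> x \<in> A" for x
        using z(4) permutes_inj[OF p] by (metis inj_image_mem_iff)
      moreover have "(\<Sum>x\<in>S. if x \<in> A then 1 else 0) = card A"
        using z(3) S by (simp add: sum.If_cases Int_absorb1)
      ultimately show "?g z \<in> ?V (2 * d)"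
        using z by (auto simp: invariant_vectors_def sum.distrib sum_distrib_left[symmetric])
    qed
  qed
  then have "card (?V (2 * d)) = card ?X" by (rule bij_betw_same_card)
  also have "\<dots> = (\<Sum>j\<le>d. card (?I j) * card (?V (d - j)))"
    using S by (simp add: card_cartesian_product finite_invariant_subsets finite_invariant_vectors)
  finally show ?thesis .
qed

text \<open>At most one entry of a vector with sum \<open>2 d\<close> exceeds \<open>d\<close>, and for an invariant vector its position
  must be fixed. Such vectors therefore correspond to a fixed point together with an invariant vector
  of sum \<open>d - 1\<close>.\<close>

lemma card_invariant_vectors_bounded:
  assumes p: "p permutes S" and S: "finite S"
  shows "card (invariant_vectors S p (2 * d)) =
    card {f \<in> invariant_vectors S p (2 * d). \<forall>x\<in>S. f x \<le> d} +
    (if d = 0 then 0 else card {x \<in> S. p x = x} * card (invariant_vectors S p (d - 1)))"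
proof -
  let ?V = "invariant_vectors S p"
  let ?big = "{f \<in> ?V (2 * d). \<not> (\<forall>x\<in>S. f x \<le> d)}"
  let ?X = "{x \<in> S. p x = x} \<times> ?V (d - 1)"
  let ?g = "\<lambda>(a, y) x. y x + (if x = a then Suc d else 0) :: nat"
  have "?V (2 * d) = {f \<in> ?V (2 * d). \<forall>x\<in>S. f x \<le> d} \<union> ?big" by blast
  then have "card (?V (2 * d)) = card ({f \<in> ?V (2 * d). \<forall>x\<in>S. f x \<le> d} \<union> ?big)" by simp
  also have "\<dots> = card {f \<in> ?V (2 * d). \<forall>x\<in>S. f x \<le> d} + card ?big"
    using finite_invariant_vectors[OF S] by (intro card_Un_disjoint) auto
  also have "card ?big = (if d = 0 then 0 else card ?X)"
  proof (cases "d = 0")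
    case True
    then have "?big = {}" using S by (auto simp: invariant_vectors_def)
    then have "card ?big = 0" by (metis card.empty)
    then show ?thesis unfolding \<open>card ?big = 0\<close> using True by simp
  next
    case False
    have sum_g: "sum (?g (a, y)) S = sum y S + Suc d" if "a \<in> S" for a y
      using that S by (simp add: sum.distrib)
    have "inj_on ?g ?X"
    proof (clarsimp simp: inj_on_def, goal_cases)
      case (1 a y b z)
      have small: "y a \<le> d - 1" "z a \<le> d - 1" "z b \<le> d - 1"
        using 1 member_le_sum[of _ S y] member_le_sum[of _ S z] S
        by (auto simp: invariant_vectors_def)
      have "a = b"
        using fun_cong[OF 1(7), of a] small False by (auto split: if_splits)
      with 1(7) show ?case by (auto simp: fun_eq_iff)
    qed
    moreover have "?g ` ?X = ?big"
    proof (intro equalityI subsetI)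
      fix f assume "f \<in> ?g ` ?X"
      then obtain a y where f: "f = ?g (a, y)" "a \<in> S" "p a = a" "y \<in> ?V (d - 1)" by auto
      have "p x = a \<longleftrightarrow> x = a" for x
        using f(3) permutes_inj[OF p] by (metis injD)
      moreover have "sum f S = 2 * d"
        using sum_g[OF f(2), of y] f(4) False unfolding f(1) by (simp add: invariant_vectors_def)
      ultimately show "f \<in> ?big"
        using f False by (auto simp: invariant_vectors_def)
    next
      fix f assume f: "f \<in> ?big"
      then obtain a where a: "a \<in> S" "f a > d" by (auto simp: not_le)
      have inv: "f (p a) = f a" and sum: "sum f S = 2 * d"
        using f a by (auto simp: invariant_vectors_def)
      \<comment> \<open>Two entries exceeding \<open>d\<close> would make the sum exceed \<open>2 d\<close>.\<close>
      have "p a = a"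
      proof (rule ccontr)
        assume "p a \<noteq> a"
        then have "sum f {a, p a} > 2 * d" using a(2) inv by simp
        moreover have "sum f {a, p a} \<le> sum f S"
          using S a(1) permutes_in_image[OF p] by (intro sum_mono2) auto
        ultimately show False using sum by simp
      qed
      \<comment> \<open>Subtracting \<open>d + 1\<close> at \<open>a\<close> is the inverse of \<open>?g\<close>; the sum drops to \<open>2 d - (d + 1) = d - 1\<close>.\<close>
      define y where "y = f(a := f a - Suc d)"
      have fy: "f = ?g (a, y)"
        using a(2) by (auto simp: y_def fun_eq_iff)
      have "sum y S = d - 1"
        using sum_g[OF a(1), of y] sum False unfolding fy by simp
      moreover have "p x = a \<longleftrightarrow> x = a" for x
        using \<open>p a = a\<close> permutes_inj[OF p] by (metis injD)
      ultimately have "y \<in> ?V (d - 1)"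
        using f a(1) by (auto simp: invariant_vectors_def y_def)
      with fy a(1) \<open>p a = a\<close> show "f \<in> ?g ` ?X" by (intro image_eqI[of _ _ "(a, y)"]) auto
    qed
    ultimately have "card ?big = card ?X"
      using card_image[of ?g ?X] by metis
    then show ?thesis using False by simp
  qed
  finally show ?thesis by (simp add: card_cartesian_product)
qed

section \<open>The coefficients of the equivariant series\<close>

lemma perm_mat_fixes_iff:
  fixes x :: "real vec"
  assumes s: "\<sigma> permutes {1..n}" and x: "x \<in> carrier_vec n"
  shows "perm_mat n \<sigma> *\<^sub>v x = x \<longleftrightarrow> (\<forall>i<n. x $ zero_based \<sigma> i = x $ i)"
proof -
  let ?t = "zero_based \<sigma>" and ?y = "perm_mat n \<sigma> *\<^sub>v x"
  have t: "?t permutes {0..<n}" using s by (rule zero_based_permutes)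
  have y: "?y $ ?t i = x $ i" if "i < n" for i
    using perm_mat_action[OF s x that] by (simp add: zero_based_def)
  have dim: "dim_vec ?y = n" "dim_vec x = n"
    using x by (auto simp: perm_mat_def)
  have "?y = x \<longleftrightarrow> (\<forall>j<n. ?y $ j = x $ j)"
    using dim by (metis eq_vecI)
  also have "\<dots> \<longleftrightarrow> (\<forall>j\<in>?t ` {0..<n}. ?y $ j = x $ j)"
    unfolding permutes_image[OF t] by auto
  also have "\<dots> \<longleftrightarrow> (\<forall>i<n. x $ ?t i = x $ i)"
    using y by auto
  finally show ?thesis .
qed

lemma lattice_points_iff:
  assumes "d > 0"
  shows "x \<in> lattice_points n d \<longleftrightarrow> x \<in> carrier_vec n \<and>
    (\<forall>i<n. x $ i \<in> \<int> \<and> 0 \<le> x $ i \<and> x $ i \<le> d) \<and> (\<Sum>i<n. x $ i) = 2 * d"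
proof
  assume "x \<in> lattice_points n d"
  then obtain y where "y \<in> hypersimplex2 n" "x = real d \<cdot>\<^sub>v y" "\<forall>i<n. x $ i \<in> \<int>"
    by (auto simp: lattice_points_def)
  then show "x \<in> carrier_vec n \<and>
      (\<forall>i<n. x $ i \<in> \<int> \<and> 0 \<le> x $ i \<and> x $ i \<le> d) \<and> (\<Sum>i<n. x $ i) = 2 * d"
    by (auto simp: hypersimplex2_def mult_left_le sum_distrib_left[symmetric])
next
  assume x: "x \<in> carrier_vec n \<and>
      (\<forall>i<n. x $ i \<in> \<int> \<and> 0 \<le> x $ i \<and> x $ i \<le> d) \<and> (\<Sum>i<n. x $ i) = 2 * d"
  let ?y = "(1 / real d) \<cdot>\<^sub>v x"
  have "?y \<in> hypersimplex2 n"
    using x assms by (auto simp: hypersimplex2_def sum_divide_distrib[symmetric])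
  moreover have "x = real d \<cdot>\<^sub>v ?y"
    using assms by (simp add: smult_smult_assoc)
  ultimately show "x \<in> lattice_points n d"
    using x by (auto simp: lattice_points_def)
qed

text \<open>In degree 0 the only vector is zero, in agreement with the convention that \<open>\<chi>\<^sub>0\<close> is trivial.\<close>

lemma perm_char_eq_card_invariant_vectors:
  assumes s: "\<sigma> permutes {1..n}"
  shows "perm_char n d \<sigma> =
    card {f \<in> invariant_vectors {0..<n} (zero_based \<sigma>) (2 * d). \<forall>i\<in>{0..<n}. f i \<le> d}"
proof (cases "d = 0")
  case True
  have "{f \<in> invariant_vectors {0..<n} (zero_based \<sigma>) 0. \<forall>i\<in>{0..<n}. f i \<le> 0} = {\<lambda>_. 0}"
    by (auto simp: invariant_vectors_def fun_eq_iff) (metis atLeastLessThan_iff le0)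
  with True show ?thesis by (simp add: perm_char_def)
next
  case False
  let ?t = "zero_based \<sigma>"
  let ?F = "{f \<in> invariant_vectors {0..<n} ?t (2 * d). \<forall>i\<in>{0..<n}. f i \<le> d}"
  let ?X = "{x \<in> lattice_points n d. perm_mat n \<sigma> *\<^sub>v x = x}"
  let ?v = "\<lambda>f. vec n (\<lambda>i. real (f i))"
  let ?w = "\<lambda>x i. if i < n then nat \<lfloor>x $ i\<rfloor> else 0"
  have t: "?t i < n \<longleftrightarrow> i < n" for i
    using permutes_in_image[OF zero_based_permutes[OF s], of i] by simp
  have X: "x \<in> ?X \<longleftrightarrow> x \<in> carrier_vec n \<and> (\<forall>i<n. x $ i \<in> \<int> \<and> 0 \<le> x $ i \<and> x $ i \<le> d) \<and>
      (\<Sum>i<n. x $ i) = 2 * d \<and> (\<forall>i<n. x $ ?t i = x $ i)" for x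
    unfolding mem_Collect_eq lattice_points_iff[OF False[unfolded neq0_conv]]
    using perm_mat_fixes_iff[OF s, of x] by blast
  have real_nat: "real (nat \<lfloor>c\<rfloor>) = c" if "c \<in> \<int>" "0 \<le> c" for c :: real
    using that by (auto elim!: Ints_cases)
  have "bij_betw ?v ?F ?X"
  proof (rule bij_betw_byWitness[where f' = ?w])
    show "\<forall>f\<in>?F. ?w (?v f) = f"
      by (auto simp: invariant_vectors_def fun_eq_iff)
    show "\<forall>x\<in>?X. ?v (?w x) = x"
    proof
      fix x assume "x \<in> ?X"
      then show "?v (?w x) = x"
        unfolding X by (intro eq_vecI) (auto simp: real_nat simp del: of_nat_nat)
    qed
    show "?v ` ?F \<subseteq> ?X"
    proof (rule image_subsetI)
      fix f assume f: "f \<in> ?F"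
      have "(\<Sum>i<n. real (f i)) = real (2 * d)"
        using f unfolding of_nat_sum[symmetric] by (simp add: invariant_vectors_def lessThan_atLeast0)
      with f t show "?v f \<in> ?X"
        unfolding X by (auto simp: invariant_vectors_def)
    qed
    show "?w ` ?X \<subseteq> ?F"
    proof (rule image_subsetI)
      fix x assume x: "x \<in> ?X"
      have "real (\<Sum>i\<in>{0..<n}. ?w x i) = (\<Sum>i<n. x $ i)"
        unfolding of_nat_sum using x unfolding X
        by (intro sum.cong) (auto simp: real_nat simp del: of_nat_nat)
      also have "\<dots> = real (2 * d)" using x unfolding X by simp
      finally have "(\<Sum>i\<in>{0..<n}. ?w x i) = 2 * d" by (simp only: of_nat_eq_iff)
      moreover have "?w x i \<le> d" if "i < n" for i
      proof -
        have "x $ i < real d + 1" using x that unfolding X by force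
        then show ?thesis by (simp add: nat_le_iff floor_le_iff)
      qed
      ultimately show "?w x \<in> ?F"
        using x t unfolding X by (simp add: invariant_vectors_def)
    qed
  qed
  then show ?thesis
    using False by (simp add: perm_char_def bij_betw_same_card)
qed

text \<open>With \<open>D = det (1 - t \<sigma>)\<close>, \<open>F\<close> the series of invariant vectors, \<open>G\<close> that of invariant subsets of even
  size and \<open>c\<close> the number of fixed points, the two counting lemmas say \<open>\<Sum> \<chi>\<^sub>d t\<^sup>d = (G - c t) F\<close>; multiply
  by \<open>D\<close> and use \<open>D F = 1\<close>.\<close>

lemma hstar_coeff_zero_based:
  assumes s: "\<sigma> permutes {1..n}"
  shows "hstar_coeff n m \<sigma> =
    of_nat (card {A \<in> invariant_subsets {0..<n} (zero_based \<sigma>). card A = 2 * m}) -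
    (if m = 1 then of_nat (card {i \<in> {0..<n}. zero_based \<sigma> i = i}) else 0)"
proof -
  let ?t = "zero_based \<sigma>" and ?N = "{0..<n}"
  let ?F = "symmetric_fps ?N ?t" and ?D = "exterior_fps ?N ?t"
  let ?G = "Abs_fps (\<lambda>j. of_nat (card {A \<in> invariant_subsets ?N ?t. card A = 2 * j})) :: complex fps"
  let ?c = "of_nat (card {i \<in> ?N. ?t i = i}) :: complex"
  have t: "?t permutes ?N" using s by (rule zero_based_permutes)
  have DF: "?D * ?F = 1"
    using t by (rule exterior_times_symmetric) simp
  have "char_series n \<sigma> = (?G - fps_const ?c * fps_X) * ?F"
  proof (rule fps_ext)
    fix d
    let ?V = "\<lambda>d. of_nat (card (invariant_vectors ?N ?t d)) :: complex"
    have "?V (2 * d) = of_nat (perm_char n d \<sigma>) + (if d = 0 then 0 else ?c * ?V (d - 1))"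
      unfolding perm_char_eq_card_invariant_vectors[OF s]
      by (subst card_invariant_vectors_bounded[OF t]) simp_all
    moreover have "?V (2 * d) = fps_nth (?G * ?F) d"
      by (subst card_invariant_vectors_double[OF t])
        (simp_all add: fps_mult_nth symmetric_fps_def atMost_atLeast0)
    moreover have "fps_nth (fps_const ?c * fps_X * ?F) d = (if d = 0 then 0 else ?c * ?V (d - 1))"
      by (simp add: mult.assoc symmetric_fps_def)
    ultimately show "fps_nth (char_series n \<sigma>) d = fps_nth ((?G - fps_const ?c * fps_X) * ?F) d"
      by (simp add: left_diff_distrib char_series_def)
  qed
  then have "char_series n \<sigma> * ?D = (?G - fps_const ?c * fps_X) * (?D * ?F)"
    by (simp add: mult_ac)
  then have "char_series n \<sigma> * ?D = ?G - fps_const ?c * fps_X"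
    unfolding DF by simp
  moreover have "hstar_series n \<sigma> = char_series n \<sigma> * ?D"
  proof -
    have "?D \<noteq> 0" using DF by auto
    moreover have "?D dvd hstar_series n \<sigma>"
      using DF by (metis dvd_triv_left dvd_trans one_dvd)
    ultimately show ?thesis
      unfolding hstar_series_eq char_denom_eq_exterior_fps[OF s] by simp
  qed
  ultimately show ?thesis
    by (simp add: hstar_coeff_def fps_X_def)
qed

lemma hstar_coeff_eq:
  assumes s: "\<sigma> permutes {1..n}"
  shows "hstar_coeff n m \<sigma> =
    of_nat (card {A \<in> {A. A \<subseteq> {1..n} \<and> card A = 2 * m}. \<sigma> ` A = A}) -
    (if m = 1 then of_nat (card {i \<in> {1..n}. \<sigma> i = i}) else 0)"
proof -
  let ?t = "zero_based \<sigma>"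
  have range: "{1..n} = Suc ` {0..<n}"
    by (simp only: image_Suc_atLeastLessThan One_nat_def atLeastLessThanSuc_atLeastAtMost)
  have im: "\<sigma> ` Suc ` A = Suc ` ?t ` A" for A
    by (simp add: image_image Suc_zero_based[OF s])
  have fixp: "card {i \<in> {1..n}. \<sigma> i = i} = card {i \<in> {0..<n}. ?t i = i}"
  proof -
    have "\<sigma> (Suc i) = Suc i \<longleftrightarrow> ?t i = i" for i
      using Suc_zero_based[OF s, of i] by auto
    then have "{i \<in> {1..n}. \<sigma> i = i} = Suc ` {i \<in> {0..<n}. ?t i = i}"
      unfolding range by blast
    then show ?thesis by (simp add: card_image)
  qed
  have subs: "card {A \<in> {A. A \<subseteq> {1..n} \<and> card A = 2 * m}. \<sigma> ` A = A} =
      card {A \<in> invariant_subsets {0..<n} ?t. card A = 2 * m}"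
  proof -
    have "{A \<in> {A. A \<subseteq> {1..n} \<and> card A = 2 * m}. \<sigma> ` A = A} =
        (`) Suc ` {A \<in> invariant_subsets {0..<n} ?t. card A = 2 * m}" (is "?L = ?R")
    proof (intro equalityI subsetI)
      fix A assume A: "A \<in> ?L"
      then have "A \<subseteq> Suc ` {0..<n}" unfolding range by blast
      then obtain B where B: "B \<subseteq> {0..<n}" "A = Suc ` B" by (rule subset_imageE)
      with A have "B \<in> {A \<in> invariant_subsets {0..<n} ?t. card A = 2 * m}"
        by (simp add: im inj_image_eq_iff card_image invariant_subsets_def)
      with B show "A \<in> ?R" by blast
    next
      fix A assume "A \<in> ?R"
      then obtain B where B: "B \<subseteq> {0..<n}" "?t ` B = B" "card B = 2 * m" "A = Suc ` B"
        by (auto simp: invariant_subsets_def)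
      have "\<sigma> ` A = A" unfolding B(4) im B(2) ..
      moreover have "A \<subseteq> {1..n}" unfolding range B(4) using B(1) by blast
      ultimately show "A \<in> ?L" using B(3,4) by (simp add: card_image)
    qed
    moreover have "inj_on ((`) Suc) X" for X
      by (simp add: inj_image_eq_iff inj_on_def)
    ultimately show ?thesis by (simp only: card_image)
  qed
  show ?thesis
    unfolding hstar_coeff_zero_based[OF s] subs fixp ..
qed

section \<open>Effective characters from group actions\<close>

text \<open>Renumbering a finite index set as \<open>{0..<k}\<close> turns a matrix representation indexed by it into one by
  \<open>k \<times> k\<close> matrices with the same traces; the inverse of the matrix of \<open>g\<close> is the matrix of \<open>g\<^sup>-\<^sup>1\<close>.\<close>

lemma effective_characterI:
  fixes G :: "('g, 'b) monoid_scheme" (structure)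
    and M :: "'g \<Rightarrow> 'i \<Rightarrow> 'i \<Rightarrow> complex"
  assumes "group G" and "finite I"
    and one: "\<And>i j. i \<in> I \<Longrightarrow> j \<in> I \<Longrightarrow> M \<one> i j = (if i = j then 1 else 0)"
    and mult: "\<And>g h i j. g \<in> carrier G \<Longrightarrow> h \<in> carrier G \<Longrightarrow> i \<in> I \<Longrightarrow> j \<in> I \<Longrightarrow>
      M (g \<otimes> h) i j = (\<Sum>k\<in>I. M g i k * M h k j)"
    and trace: "\<And>g. g \<in> carrier G \<Longrightarrow> \<chi> g = (\<Sum>i\<in>I. M g i i)"
  shows "effective_character G \<chi>"
proof -
  interpret group G by fact
  let ?k = "card I"
  obtain e where e: "bij_betw e {0..<?k} I"
    using ex_bij_betw_nat_finite[OF \<open>finite I\<close>] by blast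
  have eI: "e a \<in> I" if "a < ?k" for a
    using bij_betwE[OF e] that by auto
  have inj: "e a = e b \<longleftrightarrow> a = b" if "a < ?k" "b < ?k" for a b
    using bij_betw_imp_inj_on[OF e] that by (auto dest: inj_onD)
  have sum_e: "(\<Sum>a<?k. f (e a)) = sum f I" for f :: "'i \<Rightarrow> complex"
    using sum.reindex_bij_betw[OF e, of f] by (simp add: lessThan_atLeast0)
  let ?\<rho> = "\<lambda>g. mat ?k ?k (\<lambda>(a, b). M g (e a) (e b))"
  have \<rho>_one: "?\<rho> \<one> = 1\<^sub>m ?k"
    by (rule eq_matI) (auto simp: one eI inj)
  have \<rho>_mult: "?\<rho> (g \<otimes> h) = ?\<rho> g * ?\<rho> h" if "g \<in> carrier G" "h \<in> carrier G" for g h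
  proof (rule eq_matI)
    fix a b assume "a < dim_row (?\<rho> g * ?\<rho> h)" "b < dim_col (?\<rho> g * ?\<rho> h)"
    then show "?\<rho> (g \<otimes> h) $$ (a, b) = (?\<rho> g * ?\<rho> h) $$ (a, b)"
      using sum_e[of "\<lambda>k. M g (e a) k * M h k (e b)"]
      by (simp add: scalar_prod_def mult[OF that] eI atLeast0LessThan)
  qed simp_all
  have "?\<rho> g \<in> Units (ring_mat TYPE(complex) ?k ())" if "g \<in> carrier G" for g
    using \<rho>_mult[OF that inv_closed[OF that]] \<rho>_mult[OF inv_closed[OF that] that] that \<rho>_one
    by (auto simp: Units_def ring_mat_simps intro!: bexI[of _ "?\<rho> (inv g)"])
  then have "?\<rho> \<in> hom G (GL_complex ?k)"
    using \<rho>_mult by (intro homI) (auto simp: GL_complex_def units_of_def ring_mat_simps)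
  moreover have "\<chi> g = mat_trace (?\<rho> g)" if "g \<in> carrier G" for g
    using trace[OF that] sum_e[of "\<lambda>i. M g i i"] by (simp add: mat_trace_def)
  ultimately show ?thesis
    unfolding effective_character_def by (intro exI[of _ ?k] bexI[of _ ?\<rho>] ballI)
qed

text \<open>The difference of two permutation characters is the character of the kernel of an equivariant map
  \<open>B\<close> between the permutation modules, provided that \<open>B\<close> is surjective. Here \<open>T\<close> is a set of coordinates on
  which \<open>B\<close> is invertible, and \<open>C\<close> is the inverse of that restriction, extended by zero. Giving \<open>T\<close> and
  \<open>C\<close> explicitly makes the kernel a representation by explicit matrices.\<close>

lemma effective_fixed_points_difference:
  fixes G :: "('g, 'b) monoid_scheme" (structure)
    and B :: "'v \<Rightarrow> 'e \<Rightarrow> complex" and C :: "'e \<Rightarrow> 'v \<Rightarrow> complex"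
  assumes E: "group_action G E \<phi>" "finite E" and V: "group_action G V \<psi>" "finite V"
    and equivariant: "\<And>g v e. g \<in> carrier G \<Longrightarrow> v \<in> V \<Longrightarrow> e \<in> E \<Longrightarrow>
      B (\<psi> g v) (\<phi> g e) = B v e"
    and BC: "\<And>v w. v \<in> V \<Longrightarrow> w \<in> V \<Longrightarrow> (\<Sum>e\<in>E. B v e * C e w) = (if v = w then 1 else 0)"
    and C_support: "\<And>e v. e \<in> E - T \<Longrightarrow> v \<in> V \<Longrightarrow> C e v = 0"
    and CB: "\<And>e f. e \<in> E \<Longrightarrow> f \<in> E \<inter> T \<Longrightarrow> (\<Sum>v\<in>V. C e v * B v f) = (if e = f then 1 else 0)"
  shows "effective_character G (\<lambda>g. of_nat (card {e \<in> E. \<phi> g e = e}) - of_nat (card {v \<in> V. \<psi> g v = v}))"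
proof -
  interpret E: group_action G E \<phi> by fact
  interpret V: group_action G V \<psi> by fact
  interpret group G using E.group_hom by (simp add: group_hom_def)
  \<comment> \<open>\<open>P = 1 - C B\<close> is a projection onto \<open>ker B\<close>. Its columns in \<open>T\<close> vanish and its rows outside \<open>T\<close>
    are those of the identity, so the columns outside \<open>T\<close> form a basis of \<open>ker B\<close> and the entries
    outside \<open>T\<close> are coordinates with respect to it.\<close>
  define P where "P = (\<lambda>e f. (if e = f then 1 else 0) - (\<Sum>v\<in>V. C e v * B v f))"
  have bijE: "bij_betw (\<phi> g) E E" and bijV: "bij_betw (\<psi> g) V V" if "g \<in> carrier G" for g
    using E.bij_prop0[OF that] V.bij_prop0[OF that] by (auto simp: Bij_def)
  have inE: "\<phi> g e \<in> E" if "g \<in> carrier G" "e \<in> E" for g e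
    using bijE[OF that(1)] that(2) by (auto simp: bij_betw_def)
  have inV: "\<psi> g v \<in> V" if "g \<in> carrier G" "v \<in> V" for g v
    using bijV[OF that(1)] that(2) by (auto simp: bij_betw_def)
  have inv_inv: "\<phi> g (\<phi> (inv g) e) = e" if "g \<in> carrier G" "e \<in> E" for g e
    using that E.composition_rule[of e g "inv g"] E.id_eq_one by (metis inv_closed r_inv restrict_apply)
  have inv_invV: "\<psi> g (\<psi> (inv g) v) = v" if "g \<in> carrier G" "v \<in> V" for g v
    using that V.composition_rule[of v g "inv g"] V.id_eq_one by (metis inv_closed r_inv restrict_apply)
  have B_inv: "B v (\<phi> g e) = B (\<psi> (inv g) v) e" if "g \<in> carrier G" "v \<in> V" "e \<in> E" for g v e
    using equivariant[of g "\<psi> (inv g) v" e] that by (simp add: inv_invV inV)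
  have BP: "(\<Sum>e\<in>E. B v e * P e f) = 0" if "v \<in> V" "f \<in> E" for v f
  proof -
    have "(\<Sum>e\<in>E. B v e * (\<Sum>w\<in>V. C e w * B w f)) = (\<Sum>e\<in>E. \<Sum>w\<in>V. B v e * C e w * B w f)"
      by (simp add: sum_distrib_left mult_ac)
    also have "\<dots> = (\<Sum>w\<in>V. (\<Sum>e\<in>E. B v e * C e w) * B w f)"
      by (subst sum.swap) (simp add: sum_distrib_right)
    also have "\<dots> = B v f"
      using that V(2) by (simp add: BC if_distrib[of "\<lambda>c. c * _"] cong: sum.cong if_cong)
    finally show ?thesis
      using that E(2) by (simp add: P_def right_diff_distrib sum_subtractf if_distrib[of "\<lambda>c. _ * c"] cong: if_cong)
  qed
  show ?thesis
  proof (rule effective_characterI[where I = "E - T" and M = "\<lambda>g e. P (\<phi> (inv g) e)"])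
    show "finite (E - T)" using E(2) by simp
    show "P (\<phi> (inv \<one>) e) f = (if e = f then 1 else 0)" if "e \<in> E - T" "f \<in> E - T" for e f
    proof -
      have "\<phi> (inv \<one>) e = e" using that E.id_eq_one by (metis DiffD1 inv_one restrict_apply)
      then show ?thesis using that C_support by (simp add: P_def)
    qed
    show "P (\<phi> (inv (g \<otimes> h)) e) f = (\<Sum>k\<in>E - T. P (\<phi> (inv g) e) k * P (\<phi> (inv h) k) f)"
      if g: "g \<in> carrier G" and h: "h \<in> carrier G" and e: "e \<in> E - T" and f: "f \<in> E - T" for g h e f
    proof -
      let ?e = "\<phi> (inv g) e"
      have e': "?e \<in> E" using e g by (simp add: inE)
      \<comment> \<open>The kernel of \<open>B\<close> is stable under \<open>h\<close>, hence \<open>P\<close> acts as the identity on \<open>h P\<close>.\<close>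
      have zero: "(\<Sum>k\<in>E. B v k * P (\<phi> (inv h) k) f) = 0" if v: "v \<in> V" for v
      proof -
        have "(\<Sum>k\<in>E. B v k * P (\<phi> (inv h) k) f) =
            (\<Sum>k\<in>E. B v (\<phi> h k) * P (\<phi> (inv h) (\<phi> h k)) f)"
          by (rule sum.reindex_bij_betw[OF bijE[OF h], symmetric])
        also have "\<dots> = (\<Sum>k\<in>E. B (\<psi> (inv h) v) k * P k f)"
          using h v inv_inv[of "inv h"] by (intro sum.cong refl) (simp add: B_inv)
        also have "\<dots> = 0" using h v f by (intro BP) (auto simp: inV)
        finally show ?thesis .
      qed
      have "(\<Sum>k\<in>E - T. P ?e k * P (\<phi> (inv h) k) f) = (\<Sum>k\<in>E. P ?e k * P (\<phi> (inv h) k) f)"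
        using E(2) e' CB by (intro sum.mono_neutral_left) (auto simp: P_def)
      also have "\<dots> = (\<Sum>k\<in>E. (if ?e = k then 1 else 0) * P (\<phi> (inv h) k) f) -
          (\<Sum>k\<in>E. \<Sum>v\<in>V. C ?e v * (B v k * P (\<phi> (inv h) k) f))"
        by (simp add: P_def left_diff_distrib sum_subtractf sum_distrib_right mult.assoc)
      also have "(\<Sum>k\<in>E. (if ?e = k then 1 else 0) * P (\<phi> (inv h) k) f) = P (\<phi> (inv h) ?e) f"
        using E(2) e' by (simp add: if_distrib[of "\<lambda>c. c * _"] cong: if_cong)
      also have "(\<Sum>k\<in>E. \<Sum>v\<in>V. C ?e v * (B v k * P (\<phi> (inv h) k) f)) =
          (\<Sum>v\<in>V. C ?e v * (\<Sum>k\<in>E. B v k * P (\<phi> (inv h) k) f))"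
        by (subst sum.swap) (simp add: sum_distrib_left)
      also have "\<dots> = 0" by (simp add: zero)
      also have "\<phi> (inv h) ?e = \<phi> (inv (g \<otimes> h)) e"
        using g h e E.composition_rule[of e "inv h" "inv g"] by (simp add: inv_mult_group)
      finally show ?thesis by simp
    qed
    show "of_nat (card {e \<in> E. \<phi> g e = e}) - of_nat (card {v \<in> V. \<psi> g v = v}) =
        (\<Sum>e\<in>E - T. P (\<phi> (inv g) e) e)" if g: "g \<in> carrier G" for g
    proof -
      \<comment> \<open>\<open>tr (g C B) = tr (B g C) = tr (g B C) = tr g\<close>, the last trace being that on \<open>V\<close>.\<close>
      have fixE: "\<phi> (inv g) e = e \<longleftrightarrow> \<phi> g e = e" if "e \<in> E" for e
        using that g inv_inv[of g e] inv_inv[of "inv g" e] by auto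
      have fixV: "v = \<psi> (inv g) v \<longleftrightarrow> \<psi> g v = v" if "v \<in> V" for v
        using that g inv_invV[of g v] inv_invV[of "inv g" v] by auto
      have "(\<Sum>e\<in>E - T. P (\<phi> (inv g) e) e) = (\<Sum>e\<in>E. P (\<phi> (inv g) e) e)"
        using E(2) CB g by (intro sum.mono_neutral_left) (auto simp: P_def inE)
      also have "\<dots> = (\<Sum>e\<in>E. if \<phi> (inv g) e = e then 1 else 0) -
          (\<Sum>e\<in>E. \<Sum>v\<in>V. C (\<phi> (inv g) e) v * B v e)"
        by (simp add: P_def sum_subtractf)
      also have "(\<Sum>e\<in>E. if \<phi> (inv g) e = e then 1 else 0) = of_nat (card {e \<in> E. \<phi> g e = e})"
        using E(2) fixE by (simp add: sum.If_cases Int_def cong: conj_cong)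
      also have "(\<Sum>e\<in>E. \<Sum>v\<in>V. C (\<phi> (inv g) e) v * B v e) =
          (\<Sum>e\<in>E. \<Sum>v\<in>V. C (\<phi> (inv g) (\<phi> g e)) v * B v (\<phi> g e))"
        by (rule sum.reindex_bij_betw[OF bijE[OF g], symmetric])
      also have "\<dots> = (\<Sum>e\<in>E. \<Sum>v\<in>V. C e v * B (\<psi> (inv g) v) e)"
        using g inv_inv[of "inv g"] by (intro sum.cong refl) (simp add: B_inv)
      also have "\<dots> = (\<Sum>v\<in>V. \<Sum>e\<in>E. B (\<psi> (inv g) v) e * C e v)"
        by (subst sum.swap) (simp add: mult.commute)
      also have "\<dots> = (\<Sum>v\<in>V. if v = \<psi> (inv g) v then 1 else 0)"
        using g by (intro sum.cong refl) (auto simp: BC inV)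
      also have "\<dots> = of_nat (card {v \<in> V. \<psi> g v = v})"
        using V(2) fixV by (simp add: sum.If_cases Int_def cong: conj_cong)
      finally show ?thesis by simp
    qed
  qed (rule is_group)
qed

lemma group_action_restrict:
  fixes G :: "('g, 'b) monoid_scheme" (structure)
  assumes "group G"
    and closed: "\<And>g x. g \<in> carrier G \<Longrightarrow> x \<in> E \<Longrightarrow> f g x \<in> E"
    and one: "\<And>x. x \<in> E \<Longrightarrow> f \<one> x = x"
    and mult: "\<And>g h x. g \<in> carrier G \<Longrightarrow> h \<in> carrier G \<Longrightarrow> x \<in> E \<Longrightarrow>
      f (g \<otimes> h) x = f g (f h x)"
  shows "group_action G E (\<lambda>g. restrict (f g) E)"
proof -
  interpret group G by fact
  have bij: "restrict (f g) E \<in> Bij E" if g: "g \<in> carrier G" for g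
  proof -
    have "f g (f (inv g) x) = x" "f (inv g) (f g x) = x" if "x \<in> E" for x
      using that g mult[of g "inv g" x] mult[of "inv g" g x] one by simp_all
    then have "bij_betw (f g) E E"
      using closed g by (intro bij_betw_byWitness[where f' = "f (inv g)"]) auto
    then show ?thesis
      by (simp add: Bij_def cong: bij_betw_cong)
  qed
  have "(\<lambda>g. restrict (f g) E) \<in> hom G (BijGroup E)"
  proof (rule homI)
    fix g h assume gh: "g \<in> carrier G" "h \<in> carrier G"
    then have "restrict (f (g \<otimes> h)) E = compose E (restrict (f g) E) (restrict (f h) E)"
      by (auto simp: compose_def fun_eq_iff mult closed)
    then show "restrict (f (g \<otimes> h)) E = restrict (f g) E \<otimes>\<^bsub>BijGroup E\<^esub> restrict (f h) E"
      using gh bij by (simp add: BijGroup_def)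
  qed (use bij in \<open>simp add: BijGroup_def\<close>)
  then show ?thesis
    by (simp add: group_action_def group_hom_def group_hom_axioms_def is_group group_BijGroup)
qed

section \<open>Effectivity of the coefficients\<close>

lemma effective_character_cong:
  assumes "effective_character G \<chi>" "\<And>g. g \<in> carrier G \<Longrightarrow> \<chi>' g = \<chi> g"
  shows "effective_character G \<chi>'"
  using assms unfolding effective_character_def by auto

text \<open>A permutation character is the difference with the character of the empty set.\<close>

lemma effective_fixed_points:
  assumes "group_action G E \<phi>" "finite E"
  shows "effective_character G (\<lambda>g. of_nat (card {e \<in> E. \<phi> g e = e}))"
proof -
  interpret group_action G E \<phi> by fact
  interpret group G using group_hom by (simp add: group_hom_def)
  have "group_action G ({} :: nat set) (\<lambda>g. restrict id {})"
    by (rule group_action_restrict[where f = "\<lambda>_. id"]) (simp_all add: is_group)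
  from effective_fixed_points_difference[OF assms this, of "\<lambda>_ _. 0" "\<lambda>_ _. 0" "{}"]
  show ?thesis by simp
qed

lemma sym_group_acts_on_subsets:
  "group_action (sym_group n) {A. A \<subseteq> {1..n} \<and> card A = k}
    (\<lambda>\<sigma>. restrict ((`) \<sigma>) {A. A \<subseteq> {1..n} \<and> card A = k})"
proof (rule group_action_restrict[OF sym_group_is_group])
  fix \<sigma> A assume s: "\<sigma> \<in> carrier (sym_group n)" and A: "A \<in> {A. A \<subseteq> {1..n} \<and> card A = k}"
  then have "\<sigma> permutes {1..n}" by (simp add: sym_group_carrier)
  then have "\<sigma> ` A \<subseteq> {1..n}" "inj_on \<sigma> A"
    using A permutes_image[of \<sigma> "{1..n}"] by (auto intro: permutes_inj_on)
  with A show "\<sigma> ` A \<in> {A. A \<subseteq> {1..n} \<and> card A = k}" by (simp add: card_image)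
qed (auto simp: sym_group_def image_comp)

lemma sym_group_acts_on_points:
  "group_action (sym_group n) {1..n} (\<lambda>\<sigma>. restrict \<sigma> {1..n})"
  by (rule group_action_restrict[OF sym_group_is_group])
    (auto simp: sym_group_def permutes_in_image simp del: atLeastAtMost_iff)

text \<open>Sending an edge of the complete graph on \<open>n\<close> vertices to the sum of its end points is equivariant. It
  is surjective because for \<open>n \<ge> 3\<close> the graph contains a triangle, so that it is not bipartite.\<close>

lemma effective_pairs_minus_points:
  assumes n: "n > 2"
  shows "effective_character (sym_group n) (\<lambda>\<sigma>.
    of_nat (card {A \<in> {A. A \<subseteq> {1..n} \<and> card A = 2}. \<sigma> ` A = A}) -
    of_nat (card {i \<in> {1..n}. \<sigma> i = i}))"
proof -
  let ?E = "{A. A \<subseteq> {1..n} \<and> card A = 2}" and ?V = "{1..n}"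
  define B :: "nat \<Rightarrow> nat set \<Rightarrow> complex" where "B = (\<lambda>v e. if v \<in> e then 1 else 0)"
  define \<delta> :: "nat set \<Rightarrow> nat set \<Rightarrow> complex" where "\<delta> = (\<lambda>x e. if e = x then 1 else 0)"
  \<comment> \<open>\<open>\<alpha>\<close> has boundary the vertex 1: half of the walk 1, 2, 3, 1 with
    alternating signs, in which the contributions of 2 and of 3 cancel.
    Then \<open>{1, v} - \<alpha>\<close> has boundary \<open>v\<close>.\<close>
  define \<alpha> where "\<alpha> = (\<lambda>e. (\<delta> {1, 2} e + \<delta> {1, 3} e - \<delta> {2, 3} e) / 2)"
  define C where "C = (\<lambda>e v. if v = 1 then \<alpha> e else \<delta> {1, v} e - \<alpha> e)"
  \<comment> \<open>A star and one further edge closing an odd cycle: \<open>n\<close> edges whose boundaries form a basis.\<close>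
  define T :: "nat set set" where "T = {e. 1 \<in> e} \<union> {{2, 3}}"
  have finE: "finite ?E" by simp
  have pair: "{v, w} \<in> ?E" if "v \<in> ?V" "w \<in> ?V" "v \<noteq> w" for v w
    using that by simp
  have triangle: "{1, 2} \<in> ?E" "{1, 3} \<in> ?E" "{2, 3} \<in> ?E"
    using n by simp_all
  have B\<delta>: "(\<Sum>e\<in>?E. B v e * \<delta> x e) = B v x" if "x \<in> ?E" for v x
  proof -
    have "(\<Sum>e\<in>?E. B v e * \<delta> x e) = (\<Sum>e\<in>?E. if e = x then B v e else 0)"
      by (intro sum.cong) (auto simp: \<delta>_def)
    also have "\<dots> = B v x" using finE that by (simp add: sum.delta)
    finally show ?thesis .
  qed
  have B\<alpha>: "(\<Sum>e\<in>?E. B v e * \<alpha> e) = (if v = 1 then 1 else 0)" for v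
  proof -
    have "(\<Sum>e\<in>?E. B v e * \<alpha> e) = ((\<Sum>e\<in>?E. B v e * \<delta> {1, 2} e) +
        (\<Sum>e\<in>?E. B v e * \<delta> {1, 3} e) - (\<Sum>e\<in>?E. B v e * \<delta> {2, 3} e)) / 2"
      unfolding \<alpha>_def sum_divide_distrib sum.distrib[symmetric] sum_subtractf[symmetric]
      by (intro sum.cong) (simp_all add: algebra_simps)
    also have "\<dots> = (B v {1, 2} + B v {1, 3} - B v {2, 3}) / 2"
      unfolding triangle[THEN B\<delta>] ..
    also have "\<dots> = (if v = 1 then 1 else 0)" by (auto simp: B_def)
    finally show ?thesis .
  qed
  have "effective_character (sym_group n) (\<lambda>\<sigma>.
      of_nat (card {A \<in> ?E. restrict ((`) \<sigma>) ?E A = A}) -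
      of_nat (card {i \<in> ?V. restrict \<sigma> ?V i = i}))"
  proof (rule effective_fixed_points_difference[OF sym_group_acts_on_subsets finE
        sym_group_acts_on_points, of B C T])
    show "B (restrict \<sigma> ?V v) (restrict ((`) \<sigma>) ?E e) = B v e"
      if "\<sigma> \<in> carrier (sym_group n)" "v \<in> ?V" "e \<in> ?E" for \<sigma> v e
      using that permutes_inj[of \<sigma> ?V] by (simp add: B_def sym_group_carrier inj_image_mem_iff)
    show "(\<Sum>e\<in>?E. B v e * C e w) = (if v = w then 1 else 0)" if v: "v \<in> ?V" and w: "w \<in> ?V" for v w
    proof (cases "w = 1")
      case True
      then show ?thesis using B\<alpha> by (simp add: C_def)
    next
      case False
      have 1: "{1, w} \<in> ?E" using n w False by (intro pair) simp_all
      from False have "(\<Sum>e\<in>?E. B v e * C e w) = (\<Sum>e\<in>?E. B v e * \<delta> {1, w} e) - (\<Sum>e\<in>?E. B v e * \<alpha> e)"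
        by (simp add: C_def right_diff_distrib sum_subtractf)
      also have "\<dots> = B v {1, w} - (if v = 1 then 1 else 0)"
        unfolding B\<alpha> B\<delta>[OF 1] ..
      also have "\<dots> = (if v = w then 1 else 0)" using False by (auto simp: B_def)
      finally show ?thesis .
    qed
    show "C e v = 0" if "e \<in> ?E - T" "v \<in> ?V" for e v
      using that by (auto simp: C_def \<alpha>_def \<delta>_def T_def)
    show "(\<Sum>v\<in>?V. C e v * B v f) = (if e = f then 1 else 0)" if "e \<in> ?E" and f: "f \<in> ?E \<inter> T" for e f
    proof -
      have sum: "(\<Sum>v\<in>?V. C e v * B v {v1, v2}) = C e v1 + C e v2"
        if "v1 \<in> ?V" "v2 \<in> ?V" "v1 \<noteq> v2" for v1 v2
      proof -
        have "(\<Sum>v\<in>?V. C e v * B v {v1, v2}) = (\<Sum>v\<in>{v1, v2}. C e v)"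
          using that by (intro sum.mono_neutral_cong_right) (auto simp: B_def)
        then show ?thesis using that by simp
      qed
      show ?thesis
      proof (cases "1 \<in> f")
        case True
        moreover obtain a b where "f = {a, b}" "a \<noteq> b" using f by (auto simp: card_2_iff)
        ultimately obtain w where w: "f = {1, w}" "w \<noteq> 1" by (metis insertE insert_commute singletonD)
        then have "(\<Sum>v\<in>?V. C e v * B v f) = C e 1 + C e w"
          using f unfolding w(1) by (intro sum) auto
        also have "\<dots> = \<delta> f e" using w by (simp add: C_def)
        finally show ?thesis by (simp add: \<delta>_def)
      next
        case False
        then have f23: "f = {2, 3}" using f by (auto simp: T_def)
        have "(\<Sum>v\<in>?V. C e v * B v f) = C e 2 + C e 3"
          unfolding f23 using n by (intro sum) auto
        also have "\<dots> = \<delta> f e" by (simp add: C_def \<alpha>_def f23)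
        finally show ?thesis by (simp add: \<delta>_def)
      qed
    qed
  qed simp
  then show ?thesis
    by (rule effective_character_cong) (simp cong: conj_cong)
qed

theorem corollary5p4:
  fixes n m :: nat
  assumes "n > 2"
  shows "effective_character (sym_group n) (hstar_coeff n m)"
proof (cases "m = 1")
  case True
  show ?thesis
    by (rule effective_character_cong[OF effective_pairs_minus_points[OF assms]])
      (simp add: True hstar_coeff_eq sym_group_carrier)
next
  case False
  have "finite {A. A \<subseteq> {1..n} \<and> card A = 2 * m}" by simp
  from effective_fixed_points[OF sym_group_acts_on_subsets this] show ?thesis
    by (rule effective_character_cong)
      (use False in \<open>simp add: hstar_coeff_eq sym_group_carrier cong: conj_cong\<close>)
qed

end
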